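(* Let $m\ge 3$ and let $(X,\mathcal B)$ be a CURD (with $\lambda=1$) on $n$ varieties with partition $m^1 2^{\left(\frac{n-m}{2}\right)}$, and let $w$ be its number of parallel classes. Then $$w=\frac{n(n-1)}{m^2-2m+n}.$$
   Context: Let $X$ be a finite set of $n$ elements called varieties (or students). A block is a subset of $X$. A pairwise balanced design with index $\lambda$ is a pair $(X,\mathcal B)$, where $\mathcal B$ is a collection of blocks such that each pair of distinct varieties appears together in exactly $\lambda$ blocks. It is resolvable if $\mathcal B$ can be partitioned into sets, called parallel classes (or weeks), each of which contains each variety exactly once (i.e. the blocks of each parallel class partition $X$). It is a Class-Uniformly Resolvable Design (CURD) if moreover every parallel class has the same block sizes (with multiplicity). A CURD comes with this partition into parallel classes. A CURD on $n$ varieties has partition $m^1 2^{\left(\frac{n-m}{2}\right)}$ if each parallel class consists of exactly one block of size $m$ and exactly $\frac{n-m}{2}$ blocks of size $2$ (the case $n=m$, with no blocks of size 2, is allowed). Throughout, $\lambda=1$. *)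

theory Defs
  imports Complex_Main "HOL-Library.Multiset" "HOL-Library.Disjoint_Sets"
begin

text \<open>Collections of blocks are multisets, since for a general index a block may be repeated.\<close>

definition pairwise_balanced_design :: "'a set \<Rightarrow> 'a set multiset \<Rightarrow> nat \<Rightarrow> bool" where
  "pairwise_balanced_design X B lam \<longleftrightarrow>
     finite X \<and> (\<forall>b \<in># B. b \<subseteq> X) \<and>
     (\<forall>x \<in> X. \<forall>y \<in> X. x \<noteq> y \<longrightarrow> size {#b \<in># B. x \<in> b \<and> y \<in> b#} = lam)"

text \<open>A resolution \<open>R\<close> of \<open>B\<close> lists the parallel classes; every block of \<open>B\<close>, counted with
  multiplicity, is used in exactly one of them.\<close>

definition resolution :: "'a set \<Rightarrow> 'a set multiset \<Rightarrow> 'a set set multiset \<Rightarrow> bool" where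
  "resolution X B R \<longleftrightarrow> (\<forall>P \<in># R. partition_on X P) \<and> B = (\<Sum>P \<in># R. mset_set P)"

definition block_sizes :: "'a set set \<Rightarrow> nat multiset" where
  "block_sizes P = image_mset card (mset_set P)"

definition CURD :: "'a set \<Rightarrow> 'a set multiset \<Rightarrow> 'a set set multiset \<Rightarrow> nat \<Rightarrow> bool" where
  "CURD X B R lam \<longleftrightarrow>
     pairwise_balanced_design X B lam \<and> resolution X B R \<and>
     (\<forall>P \<in># R. \<forall>Q \<in># R. block_sizes P = block_sizes Q)"

text \<open>The partition type \<open>m\<^sup>1 2\<^sup>(\<^sup>n\<^sup>-\<^sup>m\<^sup>)\<^sup>/\<^sup>2\<close>. Truncation in \<open>-\<close> and \<open>div\<close> is harmless: as the blocks of
  a class partition \<open>X\<close>, a class with these block sizes exists only if \<open>m \<le> card X\<close> and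
  \<open>card X - m\<close> is even.\<close>

definition has_partition_m1_2 :: "'a set \<Rightarrow> 'a set set multiset \<Rightarrow> nat \<Rightarrow> bool" where
  "has_partition_m1_2 X R m \<longleftrightarrow>
     (\<forall>P \<in># R. block_sizes P = {#m#} + replicate_mset ((card X - m) div 2) 2)"

end

theory Submission
  imports Defs
begin

text \<open>Count ordered pairs of distinct varieties. Each lies in \<open>\<lambda> = 1\<close> block, giving \<open>n (n - 1)\<close>;
  on the other hand each parallel class covers
  \<open>m (m - 1) + 2 \<cdot> (n - m) / 2 = m\<^sup>2 - 2 m + n\<close> of them.\<close>

lemma card_offdiagonal:
  assumes "finite A"
  shows "card (SIGMA x:A. A - {x}) = card A * (card A - 1)"
  using assms by (simp add: card_SigmaI)

text \<open>Double counting of incidences between blocks and ordered pairs of distinct points.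
  Induction on the multiset \<open>B\<close> counts repeated blocks as often as they occur.\<close>

lemma sum_block_pairs_conv_pair_degrees:
  assumes "finite X" and "\<forall>b \<in># B. b \<subseteq> X"
  shows "(\<Sum>b\<in>#B. card b * (card b - 1)) =
    (\<Sum>(x, y)\<in>(SIGMA x:X. X - {x}). size {#b \<in># B. x \<in> b \<and> y \<in> b#})"
  using assms(2)
proof (induction B)
  case empty
  then show ?case by simp
next
  case (add c B)
  let ?D = "SIGMA x:X. X - {x}"
  have fin: "finite ?D" and "c \<subseteq> X"
    using assms(1) add.prems by auto
  \<comment> \<open>The new block \<open>c\<close> raises the degree of a pair by one exactly when
    it contains both points.\<close>
  have "(\<Sum>(x, y)\<in>?D. size {#b \<in># add_mset c B. x \<in> b \<and> y \<in> b#}) =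
      (\<Sum>p\<in>?D. (if fst p \<in> c \<and> snd p \<in> c then 1 else 0)
        + (case p of (x, y) \<Rightarrow> size {#b \<in># B. x \<in> b \<and> y \<in> b#}))"
    by (intro sum.cong) auto
  also have "\<dots> = (\<Sum>p\<in>?D. if fst p \<in> c \<and> snd p \<in> c then 1 else 0)
        + (\<Sum>(x, y)\<in>?D. size {#b \<in># B. x \<in> b \<and> y \<in> b#})"
    by (rule sum.distrib)
  also have "(\<Sum>p\<in>?D. if fst p \<in> c \<and> snd p \<in> c then 1 else 0) =
      card {p \<in> ?D. fst p \<in> c \<and> snd p \<in> c}"
    using fin by (simp flip: sum.inter_filter)
  \<comment> \<open>Since \<open>c\<close> lies inside \<open>X\<close>, the restriction to pairs
    from \<open>X\<close> loses none of the pairs in \<open>c\<close>.\<close>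
  also have "{p \<in> ?D. fst p \<in> c \<and> snd p \<in> c} = (SIGMA x:c. c - {x})"
    using \<open>c \<subseteq> X\<close> by auto
  also have "card \<dots> = card c * (card c - 1)"
    using assms(1) \<open>c \<subseteq> X\<close> by (intro card_offdiagonal) (rule finite_subset)
  finally show ?case
    using add by simp
qed

lemma pairwise_balanced_design_sum_block_pairs:
  assumes "pairwise_balanced_design X B lam"
  shows "(\<Sum>b\<in>#B. card b * (card b - 1)) = lam * (card X * (card X - 1))"
proof -
  have fin: "finite X" and sub: "\<forall>b \<in># B. b \<subseteq> X"
    and deg: "\<forall>x \<in> X. \<forall>y \<in> X. x \<noteq> y \<longrightarrow> size {#b \<in># B. x \<in> b \<and> y \<in> b#} = lam"
    using assms by (auto simp: pairwise_balanced_design_def)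
  have "(\<Sum>b\<in>#B. card b * (card b - 1)) = (\<Sum>p\<in>(SIGMA x:X. X - {x}). lam)"
    unfolding sum_block_pairs_conv_pair_degrees[OF fin sub]
    using deg by (intro sum.cong) auto
  then show ?thesis
    using card_offdiagonal[OF fin] by simp
qed

text \<open>The classes together use each block of \<open>B\<close> with its multiplicity, so a sum
  depending only on sizes can be regrouped by class. This lets the pair count be read off from the
  prescribed partition type.\<close>

lemma resolution_sum_mset:
  assumes "resolution X B R"
  shows "(\<Sum>b\<in>#B. f (card b)) = (\<Sum>P\<in>#R. \<Sum>k\<in>#block_sizes P. f k)"
proof -
  have "(\<Sum>b\<in>#(\<Sum>P\<in>#R. mset_set P). f (card b)) = (\<Sum>P\<in>#R. \<Sum>k\<in>#block_sizes P. f k)"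
    by (induction R) (simp_all add: block_sizes_def image_mset.compositionality comp_def)
  then show ?thesis
    using assms by (simp add: resolution_def)
qed

text \<open>Blocks of a partition are disjoint, so their sizes add up. This is what later rules out
  truncation in the number of blocks of size 2.\<close>

lemma sum_block_sizes:
  assumes "finite X" and "partition_on X P"
  shows "(\<Sum>k\<in>#block_sizes P. k) = card X"
proof -
  have "(\<Sum>k\<in>#block_sizes P. k) = (\<Sum>b\<in>P. card b)"
    by (simp add: block_sizes_def sum_unfold_sum_mset)
  also have "\<dots> = card (\<Union>P)"
    using assms by (intro card_Union_disjoint[symmetric])
      (auto simp: partition_on_def disjoint_def pairwise_def disjnt_def intro: finite_subset)
  finally show ?thesis
    using assms(2) by (simp add: partition_on_def)
qed

theorem theorem2p1:
  fixes X :: "'a set" and B :: "'a set multiset" and R :: "'a set set multiset"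
    and n m w :: nat
  assumes "m \<ge> 3"
    and "card X = n"
    and "CURD X B R 1"
    and "has_partition_m1_2 X R m"
    and "w = size R"
  shows "real w = real n * (real n - 1) / ((real m)\<^sup>2 - 2 * real m + real n)"
proof -
  have pbd: "pairwise_balanced_design X B 1" and res: "resolution X B R" and fin: "finite X"
    using assms(3) by (auto simp: CURD_def pairwise_balanced_design_def)
  let ?c = "real m ^ 2 - 2 * real m + real n"
  have class_pairs: "real (\<Sum>k\<in>#block_sizes P. k * (k - 1)) = ?c" if "P \<in># R" for P
  proof -
    have sizes: "block_sizes P = {#m#} + replicate_mset ((n - m) div 2) 2"
      using assms(2,4) that by (simp add: has_partition_m1_2_def)
    have "partition_on X P"
      using res that by (simp add: resolution_def)
    \<comment> \<open>The total size of the class forces \<open>m \<le> n\<close> and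
      \<open>n - m\<close> even, so \<open>-\<close> and \<open>div\<close> are exact here.\<close>
    from sum_block_sizes[OF fin this] have n: "m + ((n - m) div 2) * 2 = n"
      using assms(2) by (simp add: sizes)
    \<comment> \<open>The factor 2 is \<open>2 * (2 - 1)\<close>, the number of ordered pairs in a
      block of size 2.\<close>
    have "(\<Sum>k\<in>#block_sizes P. k * (k - 1)) = m * (m - 1) + ((n - m) div 2) * 2"
      by (simp add: sizes)
    then have "real (\<Sum>k\<in>#block_sizes P. k * (k - 1)) =
        real m * real (m - 1) + real (((n - m) div 2) * 2)"
      by (simp only: of_nat_add of_nat_mult)
    moreover have "real (m - 1) = real m - 1"
      using assms(1) by simp
    moreover have "real (((n - m) div 2) * 2) = real n - real m"
      using n by linarith
    ultimately show ?thesis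
      by (simp only: power2_eq_square) (simp add: algebra_simps)
  qed
  \<comment> \<open>For \<open>n = 0\<close> the truncated \<open>n - 1\<close> differs from
    \<open>real n - 1\<close>, but the factor \<open>n\<close> makes both sides vanish.\<close>
  have "real n * (real n - 1) = real (n * (n - 1))"
    by (cases n) (auto simp: algebra_simps)
  also have "\<dots> = real (\<Sum>P\<in>#R. \<Sum>k\<in>#block_sizes P. k * (k - 1))"
    using pairwise_balanced_design_sum_block_pairs[OF pbd] assms(2)
      resolution_sum_mset[OF res, of "\<lambda>k. k * (k - 1)"] by simp
  also have "\<dots> = (\<Sum>P\<in>#R. real (\<Sum>k\<in>#block_sizes P. k * (k - 1)))"
    by (simp add: of_nat_sum_mset image_mset.compositionality comp_def)
  also have "\<dots> = (\<Sum>P\<in>#R. ?c)"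
    using class_pairs by (simp cong: image_mset_cong)
  also have "\<dots> = real w * ?c"
    by (simp add: assms(5))
  finally have count: "real n * (real n - 1) = real w * ?c" .
  \<comment> \<open>This form shows that the denominator is positive once \<open>m \<ge> 3\<close>,
    even for \<open>n = 0\<close>, so the count may be divided by it.\<close>
  have "?c = real m * (real m - 2) + real n"
    by (simp add: power2_eq_square algebra_simps)
  moreover have "real m * (real m - 2) > 0"
    using assms(1) by simp
  ultimately have "?c > 0"
    by linarith
  then show ?thesis
    using count by (simp add: field_simps)
qed

end
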